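(* Let $X$ be a totally disconnected compact Hausdorff space, and let $A$ be a Post algebra consisting of continuous $\mathfrak Z$-valued functions on $X$, with the pointwise operations of $\mathfrak Z_{\rm Post}$. For $f,g\in A$, write $f\preceq g$ iff for each $x\in X$ either $f(x)\le g(x)\le 1-g(x)$ or $f(x)\ge g(x)\ge 1-g(x)$. Then: (i) $\preceq$ is a partial order on $A$. (ii) An element $p\in A$ is $\preceq$-minimal iff it is Boolean, i.e. $p=\nabla p$. (iii) For every $n\ge1$, consider $\mathcal F_n=\mathfrak Z^{\{1,\dots,n\}}$, viewed as the set of nonempty faces of the $n$-cube. On $\mathcal F_n$, the partial order $\sqsubseteq$ given by inclusion of faces coincides with the relation $\preceq$ of the Post algebra $(\mathcal F_n,0,1/2,1,\neg,\nabla,\vee,\wedge)$ with pointwise operations.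
   Context: Let $\mathfrak Z=\{0,1/2,1\}$. $\mathfrak Z_{\rm Post}=(\mathfrak Z,0,1/2,1,\neg,\nabla,\vee,\wedge)$ has $\neg x=1-x$, $\nabla x=\min(1,2x)$, $x\vee y=\max(x,y)$, $x\wedge y=\min(x,y)$. Operations on function algebras are applied pointwise. A function $f\colon\{1,\dots,n\}\to\mathfrak Z$ is identified with the nonempty face $\{x\in[0,1]^n: x_i=f(i)\text{ whenever } f(i)\in\{0,1\}\}$ of the cube $[0,1]^n$. Under this identification, face inclusion $f\sqsubseteq g$ holds iff $f\sqcup g=g$ pointwise, where $x\sqcup y=x$ if $x=y$ and $x\sqcup y=1/2$ otherwise. *)

theory Defs
  imports "HOL-Analysis.Analysis"
begin

definition post_values :: "real set" where
  "post_values = {0, 1/2, 1}"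

definition post_neg :: "real \<Rightarrow> real" where
  "post_neg x = 1 - x"

definition post_nabla :: "real \<Rightarrow> real" where
  "post_nabla x = min 1 (2 * x)"

text \<open>
  A function on a carrier set \<open>S\<close> is an element of \<open>extensional S\<close>, so that equality in HOL is
  equality on \<open>S\<close>; the constants and operations below are restricted to \<open>S\<close> accordingly.
\<close>

definition fconst :: "'a set \<Rightarrow> real \<Rightarrow> 'a \<Rightarrow> real" where
  "fconst S c = (\<lambda>x\<in>S. c)"

definition fneg :: "'a set \<Rightarrow> ('a \<Rightarrow> real) \<Rightarrow> 'a \<Rightarrow> real" where
  "fneg S f = (\<lambda>x\<in>S. post_neg (f x))"

definition fnabla :: "'a set \<Rightarrow> ('a \<Rightarrow> real) \<Rightarrow> 'a \<Rightarrow> real" where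
  "fnabla S f = (\<lambda>x\<in>S. post_nabla (f x))"

definition fsup :: "'a set \<Rightarrow> ('a \<Rightarrow> real) \<Rightarrow> ('a \<Rightarrow> real) \<Rightarrow> 'a \<Rightarrow> real" where
  "fsup S f g = (\<lambda>x\<in>S. max (f x) (g x))"

definition finf :: "'a set \<Rightarrow> ('a \<Rightarrow> real) \<Rightarrow> ('a \<Rightarrow> real) \<Rightarrow> 'a \<Rightarrow> real" where
  "finf S f g = (\<lambda>x\<in>S. min (f x) (g x))"

text \<open>
  Subalgebras, in the signature \<open>(0, 1/2, 1, \<not>, \<nabla>, \<or>, \<and>)\<close>, of the power of the three-element Post
  algebra, all of whose members are continuous for the discrete topology on the values.
\<close>

definition post_function_algebra :: "'a topology \<Rightarrow> ('a \<Rightarrow> real) set \<Rightarrow> bool" where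
  "post_function_algebra X A \<longleftrightarrow>
     (let S = topspace X in
       (\<forall>f\<in>A. f \<in> extensional S \<and> continuous_map X (discrete_topology post_values) f) \<and>
       fconst S 0 \<in> A \<and> fconst S (1/2) \<in> A \<and> fconst S 1 \<in> A \<and>
       (\<forall>f\<in>A. fneg S f \<in> A) \<and>
       (\<forall>f\<in>A. fnabla S f \<in> A) \<and>
       (\<forall>f\<in>A. \<forall>g\<in>A. fsup S f g \<in> A) \<and>
       (\<forall>f\<in>A. \<forall>g\<in>A. finf S f g \<in> A))"

definition totally_disconnected_space :: "'a topology \<Rightarrow> bool" where
  "totally_disconnected_space X \<longleftrightarrow> (\<forall>C. connectedin X C \<longrightarrow> (\<forall>x\<in>C. \<forall>y\<in>C. x = y))"

definition prec_rel :: "'a set \<Rightarrow> ('a \<Rightarrow> real) set \<Rightarrow> ('a \<Rightarrow> real) rel" where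
  "prec_rel S A = {(f, g). f \<in> A \<and> g \<in> A \<and>
     (\<forall>x\<in>S. (f x \<le> g x \<and> g x \<le> 1 - g x) \<or> (f x \<ge> g x \<and> g x \<ge> 1 - g x))}"

definition minimal_in :: "'b set \<Rightarrow> 'b rel \<Rightarrow> 'b \<Rightarrow> bool" where
  "minimal_in A r p \<longleftrightarrow> p \<in> A \<and> (\<forall>q\<in>A. (q, p) \<in> r \<longrightarrow> q = p)"

definition face_functions :: "nat \<Rightarrow> (nat \<Rightarrow> real) set" where
  "face_functions n = {1..n} \<rightarrow>\<^sub>E post_values"

text \<open>The points of the cube \<open>[0,1]^n\<close> are the extensional functions from \<open>{1..n}\<close> to \<open>[0,1]\<close>.\<close>

definition cube_face :: "nat \<Rightarrow> (nat \<Rightarrow> real) \<Rightarrow> (nat \<Rightarrow> real) set" where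
  "cube_face n f = {x \<in> {1..n} \<rightarrow>\<^sub>E {0..1}. \<forall>i\<in>{1..n}. f i \<in> {0, 1} \<longrightarrow> x i = f i}"

definition face_inclusion :: "nat \<Rightarrow> (nat \<Rightarrow> real) rel" where
  "face_inclusion n = {(f, g). f \<in> face_functions n \<and> g \<in> face_functions n \<and>
     cube_face n f \<subseteq> cube_face n g}"

end

theory Submission
  imports Defs
begin

text \<open>
  On \<open>{0, 1/2, 1}\<close> the condition defining \<open>\<preceq>\<close> at a point says that the two values agree or that
  the upper one is \<open>1/2\<close>. Hence \<open>\<nabla>p \<preceq> p\<close> for every \<open>p\<close>, so that a minimal element is Boolean.
  Likewise a face contains another iff their functions agree wherever the larger one is not free;
  for necessity it suffices to test the centre of the smaller face.
\<close>

text \<open>\<open>b \<le> 1 - b\<close> means \<open>b \<le> 1/2\<close>. So \<open>b = 0\<close>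
  leaves only \<open>a \<le> 0\<close> and \<open>b = 1\<close> only \<open>a \<ge> 1\<close>, while
  \<open>b = 1/2\<close> meets both bounds and one of the two comparisons with \<open>a\<close>
  always holds.\<close>

lemma prec_values_iff:
  fixes a b :: real
  assumes "a \<in> post_values" "b \<in> post_values"
  shows "(a \<le> b \<and> b \<le> 1 - b) \<or> (a \<ge> b \<and> b \<ge> 1 - b) \<longleftrightarrow> a = b \<or> b = 1/2"
  using assms by (auto simp: post_values_def)

text \<open>Stated for any set of such functions, so that it serves both the given algebra and
  \<open>face_functions n\<close>.\<close>

lemma prec_rel_iff:
  assumes "A \<subseteq> S \<rightarrow>\<^sub>E post_values"
  shows "(f, g) \<in> prec_rel S A \<longleftrightarrow> f \<in> A \<and> g \<in> A \<and> (\<forall>x\<in>S. f x = g x \<or> g x = 1/2)"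
proof (cases "f \<in> A \<and> g \<in> A")
  case True
  then have "(f x \<le> g x \<and> g x \<le> 1 - g x) \<or> (f x \<ge> g x \<and> g x \<ge> 1 - g x)
      \<longleftrightarrow> f x = g x \<or> g x = 1/2" if "x \<in> S" for x
    using assms that by (intro prec_values_iff) auto
  with True show ?thesis
    unfolding prec_rel_def by simp
qed (auto simp: prec_rel_def)

lemma partial_order_on_prec_rel:
  assumes "A \<subseteq> S \<rightarrow>\<^sub>E post_values"
  shows "partial_order_on A (prec_rel S A)"
proof -
  note iff = prec_rel_iff[OF assms]
  have "prec_rel S A \<subseteq> A \<times> A"
    by (auto simp: prec_rel_def)
  moreover have "refl_on A (prec_rel S A)"
    by (auto simp: refl_on_def iff)
  moreover have "trans (prec_rel S A)"
  proof (rule transI)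
    fix f g h assume "(f, g) \<in> prec_rel S A" "(g, h) \<in> prec_rel S A"
    \<comment> \<open>If \<open>h x\<close> is not \<open>1/2\<close>, then \<open>g x = h x\<close>
      is not \<open>1/2\<close> either, which forces \<open>f x = g x\<close>.\<close>
    then show "(f, h) \<in> prec_rel S A"
      unfolding iff by metis
  qed
  moreover have "antisym (prec_rel S A)"
  proof (rule antisymI)
    fix f g assume *: "(f, g) \<in> prec_rel S A" "(g, f) \<in> prec_rel S A"
    then have "f \<in> S \<rightarrow>\<^sub>E post_values" "g \<in> S \<rightarrow>\<^sub>E post_values"
      using assms by (auto simp: prec_rel_def)
    \<comment> \<open>Distinct values at \<open>x\<close> would force both \<open>g x = 1/2\<close>
      and \<open>f x = 1/2\<close>.\<close>
    then show "f = g"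
      by (rule PiE_ext) (use * in \<open>force simp: iff\<close>)
  qed
  ultimately show ?thesis
    by (simp add: partial_order_on_def preorder_on_def)
qed

lemma minimal_in_prec_rel_iff:
  assumes A: "A \<subseteq> S \<rightarrow>\<^sub>E post_values"
    and p: "p \<in> A" and nabla: "fnabla S p \<in> A"
  shows "minimal_in A (prec_rel S A) p \<longleftrightarrow> p = fnabla S p"
proof
  assume "minimal_in A (prec_rel S A) p"
  \<comment> \<open>\<open>post_nabla\<close> fixes 0 and 1 and moves only \<open>1/2\<close>, to
    1.\<close>
  moreover have "fnabla S p x = p x \<or> p x = 1/2" if "x \<in> S" for x
  proof -
    have "p x \<in> post_values" using A p that by auto
    then show ?thesis
      using that by (auto simp: fnabla_def post_nabla_def post_values_def)
  qed
  then have "(fnabla S p, p) \<in> prec_rel S A"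
    using p nabla by (simp add: prec_rel_iff[OF A])
  ultimately show "p = fnabla S p"
    using nabla by (auto simp: minimal_in_def)
next
  assume "p = fnabla S p"
  then have "p x = post_nabla (p x)" if "x \<in> S" for x
    using that by (metis fnabla_def restrict_apply')
  \<comment> \<open>Since \<open>post_nabla (1/2) = 1\<close>, a fixed point avoids the value
    \<open>1/2\<close>; below such a \<open>p\<close> the relation leaves only equality.\<close>
  then have half: "p x \<noteq> 1/2" if "x \<in> S" for x
    using that by (force simp: post_nabla_def)
  show "minimal_in A (prec_rel S A) p"
    unfolding minimal_in_def
  proof (intro conjI ballI impI)
    fix q assume q: "q \<in> A" "(q, p) \<in> prec_rel S A"
    then have "q \<in> S \<rightarrow>\<^sub>E post_values" "p \<in> S \<rightarrow>\<^sub>E post_values"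
      using A p by auto
    then show "q = p"
      by (rule PiE_ext) (use q half in \<open>auto simp: prec_rel_iff[OF A]\<close>)
  qed (rule p)
qed

lemma post_values_closed:
  "0 \<in> post_values" "1/2 \<in> post_values" "1 \<in> post_values"
  "a \<in> post_values \<Longrightarrow> post_neg a \<in> post_values"
  "a \<in> post_values \<Longrightarrow> post_nabla a \<in> post_values"
  "a \<in> post_values \<Longrightarrow> b \<in> post_values \<Longrightarrow> max a b \<in> post_values"
  "a \<in> post_values \<Longrightarrow> b \<in> post_values \<Longrightarrow> min a b \<in> post_values"
  by (auto simp: post_values_def post_neg_def post_nabla_def)

text \<open>With the discrete topology on \<open>{1..n}\<close> every function into
  \<open>post_values\<close> is continuous, so only closure of the values under the operations
  remains.\<close>

lemma post_function_algebra_face_functions: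
  "post_function_algebra (discrete_topology {1..n}) (face_functions n)"
  unfolding post_function_algebra_def Let_def topspace_discrete_topology
    face_functions_def fconst_def fneg_def fnabla_def fsup_def finf_def
  by (intro conjI ballI)
    (simp_all add: restrict_PiE_iff post_values_closed PiE_mem PiE_iff)

lemma cube_face_subset_iff:
  assumes f: "f \<in> face_functions n" and g: "g \<in> face_functions n"
  shows "cube_face n f \<subseteq> cube_face n g \<longleftrightarrow> (\<forall>i\<in>{1..n}. f i = g i \<or> g i = 1/2)"
proof
  assume sub: "cube_face n f \<subseteq> cube_face n g"
  \<comment> \<open>As a point of the cube, \<open>f\<close> is the centre of its own face.\<close>
  have "f i \<in> {0..1}" if "i \<in> {1..n}" for i
    using PiE_mem[OF f[unfolded face_functions_def] that] by (auto simp: post_values_def)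
  then have "f \<in> cube_face n f"
    using f by (simp add: cube_face_def face_functions_def PiE_iff)
  with sub have eq: "f i = g i" if "i \<in> {1..n}" "g i \<in> {0, 1}" for i
    using that by (auto simp: cube_face_def)
  show "\<forall>i\<in>{1..n}. f i = g i \<or> g i = 1/2"
  proof
    fix i assume i: "i \<in> {1..n}"
    then have "g i \<in> post_values"
      using g by (simp add: face_functions_def PiE_iff)
    with eq[OF i] show "f i = g i \<or> g i = 1/2"
      by (auto simp: post_values_def)
  qed
next
  assume "\<forall>i\<in>{1..n}. f i = g i \<or> g i = 1/2"
  \<comment> \<open>The coordinates fixed by \<open>g\<close> are fixed by \<open>f\<close> at the
    same values, so the constraints defining the face of \<open>g\<close> are among those for
    \<open>f\<close>.\<close>
  then have "f i = g i" if "i \<in> {1..n}" "g i \<in> {0, 1}" for i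
    using that by fastforce
  then show "cube_face n f \<subseteq> cube_face n g"
    unfolding cube_face_def by auto
qed

lemma face_inclusion_eq_prec_rel:
  "face_inclusion n = prec_rel {1..n} (face_functions n)"
proof -
  have "face_functions n \<subseteq> {1..n} \<rightarrow>\<^sub>E post_values"
    by (simp add: face_functions_def)
  note iff = prec_rel_iff[OF this]
  have "(f, g) \<in> face_inclusion n \<longleftrightarrow> (f, g) \<in> prec_rel {1..n} (face_functions n)" for f g
    unfolding iff using cube_face_subset_iff[of f n g] by (auto simp: face_inclusion_def)
  then show ?thesis by auto
qed

theorem theorem4p4:
  fixes X :: "'a topology" and A :: "('a \<Rightarrow> real) set"
  assumes "compact_space X" and "Hausdorff_space X" and "totally_disconnected_space X"
    and "post_function_algebra X A"
  shows "partial_order_on A (prec_rel (topspace X) A) \<and>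
    (\<forall>p\<in>A. minimal_in A (prec_rel (topspace X) A) p \<longleftrightarrow> p = fnabla (topspace X) p) \<and>
    (\<forall>n\<ge>1. post_function_algebra (discrete_topology {1..n}) (face_functions n) \<and>
       face_inclusion n = prec_rel {1..n} (face_functions n))"
proof -
  \<comment> \<open>Continuity into \<open>discrete_topology post_values\<close> confines the values
    to \<open>post_values\<close>.\<close>
  have A: "A \<subseteq> topspace X \<rightarrow>\<^sub>E post_values"
  proof
    fix f assume "f \<in> A"
    then have "continuous_map X (discrete_topology post_values) f" "f \<in> extensional (topspace X)"
      using assms(4) by (simp_all add: post_function_algebra_def Let_def)
    then show "f \<in> topspace X \<rightarrow>\<^sub>E post_values"
      using continuous_map_funspace[of X "discrete_topology post_values" f]
      by (simp add: PiE_def)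
  qed
  have nabla: "fnabla (topspace X) p \<in> A" if "p \<in> A" for p
    using assms(4) that by (simp add: post_function_algebra_def Let_def)
  show ?thesis
    by (intro conjI ballI allI impI partial_order_on_prec_rel[OF A]
        minimal_in_prec_rel_iff[OF A] nabla post_function_algebra_face_functions
        face_inclusion_eq_prec_rel)
qed

end
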